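(* For every integer $n\ge 1$, $$R_n(t)=\sum_{\sigma\in\mathcal{RS}\mathrm{II}_n} t^{\,n-2\,\mathrm{nva}(\sigma)}.$$
   Context: The polynomial $R_n$ is defined by $\frac{d^n}{dx^n}\sec^2 x=R_n(\tan x)\sec^2 x$. A signed permutation of $[n]=\{1,\dots,n\}$ is a bijection $\sigma$ of $\{\pm1,\dots,\pm n\}$ onto itself with $\sigma(-i)=-\sigma(i)$, written $\sigma=(\sigma_1,\dots,\sigma_n)$ with $\sigma_i=\sigma(i)$; $B_n$ is the set of these. For $1\le k\le n$, $\sigma_{[k]}$ is the subword of $\sigma$ obtained by removing all entries of absolute value greater than $k$. A double descent of a word of distinct integers is a triple of consecutive letters $a>b>c$. $\mathcal{RS}\mathrm{II}_n$ (signed Simsun permutations of type II) is the set of $\sigma\in B_n$ such that $\sigma_{[k]}$ contains no double descent for all $1\le k\le n$. For $\sigma\in\mathcal{RS}\mathrm{II}_n$, $\mathrm{nva}(\sigma)=\#\{i:2\le i\le n,\ \sigma_i<0,\ \sigma_{i-1}>\sigma_i,\ |\sigma_{i-1}|<|\sigma_i|\}$. *)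

theory Defs
  imports "HOL-Analysis.Analysis" "HOL-Combinatorics.Permutations"
    "HOL-Computational_Algebra.Polynomial"
begin

definition sec :: "real \<Rightarrow> real" where
  "sec x = 1 / cos x"

(* The zeros of cos are poles of sec and are excluded; on their open complement deriv is the
   genuine derivative, whatever values sec is given at the poles. Existence and uniqueness of the
   described polynomial are proved in Rpoly_ex1. *)
definition Rpoly :: "nat \<Rightarrow> real poly" where
  "Rpoly n = (THE p. \<forall>x. cos x \<noteq> 0 \<longrightarrow>
     (deriv ^^ n) (\<lambda>y. sec y ^ 2) x = poly p (tan x) * sec x ^ 2)"

(* A signed permutation of {1,...,n} is extended by the identity to all integers. *)
definition signed_perms :: "nat \<Rightarrow> (int \<Rightarrow> int) set" where
  "signed_perms n = {\<sigma>. \<sigma> permutes ({- int n..int n} - {0}) \<and> (\<forall>i. \<sigma> (- i) = - \<sigma> i)}"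

definition word :: "nat \<Rightarrow> (int \<Rightarrow> int) \<Rightarrow> int list" where
  "word n \<sigma> = map (\<lambda>i. \<sigma> (int i)) [1..<Suc n]"

definition subword :: "nat \<Rightarrow> nat \<Rightarrow> (int \<Rightarrow> int) \<Rightarrow> int list" where
  "subword n k \<sigma> = filter (\<lambda>a. \<bar>a\<bar> \<le> int k) (word n \<sigma>)"

definition has_double_descent :: "int list \<Rightarrow> bool" where
  "has_double_descent w \<longleftrightarrow>
     (\<exists>i. i + 2 < length w \<and> w ! i > w ! (i + 1) \<and> w ! (i + 1) > w ! (i + 2))"

definition RSII :: "nat \<Rightarrow> (int \<Rightarrow> int) set" where
  "RSII n = {\<sigma> \<in> signed_perms n. \<forall>k\<in>{1..n}. \<not> has_double_descent (subword n k \<sigma>)}"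

definition nva :: "nat \<Rightarrow> (int \<Rightarrow> int) \<Rightarrow> nat" where
  "nva n \<sigma> = card {i \<in> {2..int n}. \<sigma> i < 0 \<and> \<sigma> (i - 1) > \<sigma> i \<and> \<bar>\<sigma> (i - 1)\<bar> < \<bar>\<sigma> i\<bar>}"

lemma Rpoly_ex1:
  "\<exists>!p. \<forall>x. cos x \<noteq> 0 \<longrightarrow>
     (deriv ^^ n) (\<lambda>y. sec y ^ 2) x = poly p (tan x) * sec x ^ 2"
proof (rule ex_ex1I)
  show "\<exists>p. \<forall>x. cos x \<noteq> 0 \<longrightarrow>
     (deriv ^^ n) (\<lambda>y. sec y ^ 2) x = poly p (tan x) * sec x ^ 2"
  proof (induction n)
    case 0
    show ?case by (intro exI[of _ 1]) simp
  next
    case (Suc n)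
    then obtain p where p: "\<And>x. cos x \<noteq> 0 \<Longrightarrow>
        (deriv ^^ n) (\<lambda>y. sec y ^ 2) x = poly p (tan x) * sec x ^ 2"
      by blast
    define q where "q = [:0, 2:] * p + [:1, 0, 1:] * pderiv p"
    have op: "open {x::real. cos x \<noteq> 0}"
      by (intro open_Collect_neq continuous_intros)
    have "(deriv ^^ Suc n) (\<lambda>y. sec y ^ 2) x = poly q (tan x) * sec x ^ 2"
      if x: "cos x \<noteq> 0" for x
    proof -
      have t2: "1 + tan x ^ 2 = sec x ^ 2"
        using x sin_cos_squared_add[of x]
        by (simp add: sec_def tan_def field_simps power2_eq_square)
      have d1: "(tan has_real_derivative sec x ^ 2) (at x)"
        using DERIV_tan[OF x] by (simp add: sec_def power_one_over divide_inverse power_inverse)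
      have d2: "((\<lambda>y. sec y ^ 2) has_real_derivative 2 * tan x * sec x ^ 2) (at x)"
        unfolding sec_def using x
        by (auto intro!: derivative_eq_intros simp: tan_def field_simps power2_eq_square)
      have d3: "((\<lambda>y. poly p (tan y)) has_real_derivative poly (pderiv p) (tan x) * sec x ^ 2) (at x)"
        by (rule DERIV_chain2[OF poly_DERIV d1])
      have d4: "((\<lambda>y. poly p (tan y) * sec y ^ 2) has_real_derivative poly q (tan x) * sec x ^ 2) (at x)"
        by (rule DERIV_cong[OF DERIV_mult[OF d3 d2]])
           (simp add: q_def algebra_simps flip: t2, simp add: power2_eq_square power4_eq_xxxx algebra_simps)
      have "((deriv ^^ n) (\<lambda>y. sec y ^ 2) has_real_derivative poly q (tan x) * sec x ^ 2) (at x)"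
        by (rule has_field_derivative_transform_within_open[OF d4 op]) (use x p in auto)
      then show ?thesis by (simp add: DERIV_imp_deriv)
    qed
    then show ?case by blast
  qed
next
  fix p q
  assume p: "\<forall>x. cos x \<noteq> 0 \<longrightarrow>
     (deriv ^^ n) (\<lambda>y. sec y ^ 2) x = poly p (tan x) * sec x ^ 2"
    and q: "\<forall>x. cos x \<noteq> 0 \<longrightarrow>
     (deriv ^^ n) (\<lambda>y. sec y ^ 2) x = poly q (tan x) * sec x ^ 2"
  have "poly p t = poly q t" for t
  proof -
    have c: "cos (arctan t) \<noteq> 0" by simp
    then have "poly p t * sec (arctan t) ^ 2 = poly q t * sec (arctan t) ^ 2"
      using p q tan_arctan by metis
    with c show ?thesis by (simp add: sec_def)
  qed
  then show "p = q" by (simp add: poly_eq_poly_eq_iff[symmetric] ext)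
qed

lemma Rpoly_spec:
  "cos x \<noteq> 0 \<Longrightarrow> (deriv ^^ n) (\<lambda>y. sec y ^ 2) x = poly (Rpoly n) (tan x) * sec x ^ 2"
  using theI'[OF Rpoly_ex1] unfolding Rpoly_def by blast

(* The natural-number exponent n - 2 * nva n \<sigma> is therefore never truncated on RSII n. *)
lemma two_nva_le:
  assumes "\<sigma> \<in> RSII n"
  shows "2 * nva n \<sigma> \<le> n"
proof (cases "n = 0")
  case True
  then show ?thesis by (simp add: nva_def)
next
  case False
  define S where
    "S = {i \<in> {2..int n}. \<sigma> i < 0 \<and> \<sigma> (i - 1) > \<sigma> i \<and> \<bar>\<sigma> (i - 1)\<bar> < \<bar>\<sigma> i\<bar>}"
  have fin: "finite S" unfolding S_def by (rule finite_subset[of _ "{2..int n}"]) auto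
  have perm: "\<sigma> permutes ({- int n..int n} - {0})"
    using assms by (auto simp: RSII_def signed_perms_def)
  have "\<bar>\<sigma> (int i)\<bar> \<le> int n" if "i \<in> set [1..<Suc n]" for i
  proof -
    have "int i \<in> {- int n..int n} - {0}" using that by auto
    then have "\<sigma> (int i) \<in> {- int n..int n} - {0}" using permutes_in_image[OF perm] by blast
    then show ?thesis by auto
  qed
  then have sw: "subword n n \<sigma> = word n \<sigma>"
    by (auto simp: subword_def word_def filter_id_conv simp del: upt_Suc)
  have ndd: "\<not> has_double_descent (word n \<sigma>)"
    using assms False sw by (auto simp: RSII_def dest!: bspec[of _ _ n])
  have disj: "S \<inter> (\<lambda>i. i - 1) ` S = {}"
  proof (rule ccontr)
    assume "S \<inter> (\<lambda>i. i - 1) ` S \<noteq> {}"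
    then obtain i where i: "i \<in> S" "i + 1 \<in> S" by force
    define j where "j = nat (i - 2)"
    have j: "i = int j + 2" using i by (auto simp: S_def j_def)
    have "j + 2 < length (word n \<sigma>)" using i j by (auto simp: S_def word_def)
    moreover have "word n \<sigma> ! j = \<sigma> (i - 1)" "word n \<sigma> ! (j + 1) = \<sigma> i"
      "word n \<sigma> ! (j + 2) = \<sigma> (i + 1)"
      using i j by (auto simp: S_def word_def algebra_simps simp del: upt_Suc)
    ultimately have "has_double_descent (word n \<sigma>)"
      using i unfolding has_double_descent_def S_def by (intro exI[of _ j]) auto
    with ndd show False by simp
  qed
  have "card S + card S = card S + card ((\<lambda>i. i - 1) ` S)"
    by (simp add: card_image inj_on_def)
  also have "\<dots> = card (S \<union> (\<lambda>i. i - 1) ` S)"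
    using fin disj by (simp add: card_Un_disjoint)
  also have "\<dots> \<le> card {1..int n}"
    by (rule card_mono) (auto simp: S_def)
  finally show ?thesis by (simp add: nva_def S_def)
qed

lemma finite_RSII: "finite (RSII n)"
proof (rule finite_subset)
  show "RSII n \<subseteq> {\<sigma>. \<sigma> permutes ({- int n..int n} - {0})}"
    by (auto simp: RSII_def signed_perms_def)
qed (simp add: finite_permutations)

end

theory Submission
  imports Defs
begin

text \<open>
Differentiating once more gives the recurrence
\<open>R\<^sub>n\<^sub>+\<^sub>1 = 2 t R\<^sub>n + (1 + t\<^sup>2) R\<^sub>n'\<close> (\<open>Rpoly_Suc\<close>), under which a monomial \<open>t\<^sup>m\<close> produces
\<open>(m + 2) t\<^sup>m\<^sup>+\<^sup>1 + m t\<^sup>m\<^sup>-\<^sup>1\<close>. The sum over signed Simsun permutations of size \<open>n + 1\<close>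
is compared with the one of size \<open>n\<close> by removing the letter of largest absolute value.

Call a descent \<open>a > b\<close> positive if \<open>\<bar>a\<bar> > \<bar>b\<bar>\<close> and negative if \<open>\<bar>a\<bar> < \<bar>b\<bar>\<close>; the
statistic \<open>nva\<close> counts the negative ones, because a negative descent forces \<open>b < 0\<close>. Let a
word of size \<open>n\<close> have \<open>p\<close> positive and \<open>q\<close> negative descents. The letter \<open>n + 1\<close> may be
inserted anywhere except directly before a descent top: at the end or inside a positive descent
\<open>(p, q)\<close> is kept, inside a negative descent it becomes \<open>(p + 1, q - 1)\<close>, and each of the
other \<open>n - 2 (p + q)\<close> places gives \<open>(p + 1, q)\<close> (\<open>insertion_sum_max\<close>). Reversing a word
and negating its letters exchanges the two kinds of descent, so \<open>-(n + 1)\<close> behaves in the same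
way with \<open>p\<close> and \<open>q\<close> exchanged (\<open>insertion_sum_min\<close>).

These numbers of children depend on \<open>p\<close> as well as on \<open>q\<close>, whereas the recurrence for
\<open>R\<^sub>n\<close> sees only \<open>q\<close>, so the two do not match word by word. They match on average: if
\<open>F(x, y)\<close> is the generating function of the pairs \<open>(p, q)\<close>, then
\<open>(\<partial>/\<partial>y - \<partial>/\<partial>x) F = 0\<close>, that is, among the words with \<open>d\<close> descents the number
of negative ones is distributed like the number of heads in \<open>d\<close> tosses of a fair coin. This symmetry is inherited from size
\<open>n\<close> to size \<open>n + 1\<close> because \<open>\<partial>/\<partial>y - \<partial>/\<partial>x\<close> commutes with the insertion operator up to a
shift of its parameter (\<open>growth_exchange\<close>, \<open>sum_exchange_simsun_words\<close>). The discrepancy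
between insertion and recurrence is exactly an instance of the symmetry (\<open>growth_power\<close>), so
it disappears in the sum over all words.
\<close>

section \<open>The derivative polynomials of the squared secant\<close>

lemma Rpoly_0: "Rpoly 0 = 1"
proof -
  have "poly (Rpoly 0) t = poly 1 t" for t
    using Rpoly_spec[of "arctan t" 0] by (simp add: sec_def tan_arctan)
  then show ?thesis by (simp add: poly_eq_poly_eq_iff[symmetric] ext)
qed

lemma Rpoly_Suc: "Rpoly (Suc n) = [:0, 2:] * Rpoly n + [:1, 0, 1:] * pderiv (Rpoly n)"
  (is "_ = ?q")
proof -
  let ?D = "(deriv ^^ n) (\<lambda>y. sec y ^ 2)"
  have D: "deriv ?D x = poly ?q (tan x) * sec x ^ 2" if x: "cos x \<noteq> 0" for x
  proof -
    have sec2: "sec x ^ 2 = 1 + tan x ^ 2"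
      using tan_sec[OF x] by (simp add: sec_def inverse_eq_divide)
    have tan': "(tan has_real_derivative sec x ^ 2) (at x)"
      using DERIV_tan[OF x] by (simp add: sec_def power_one_over divide_inverse power_inverse)
    have sec2': "((\<lambda>y. sec y ^ 2) has_real_derivative 2 * tan x * sec x ^ 2) (at x)"
      unfolding sec_def using x
      by (auto intro!: derivative_eq_intros simp: tan_def field_simps power2_eq_square)
    have q: "poly ?q (tan x) = 2 * tan x * poly (Rpoly n) (tan x)
        + sec x ^ 2 * poly (pderiv (Rpoly n)) (tan x)"
      unfolding sec2 by (simp add: algebra_simps power2_eq_square)
    have "((\<lambda>y. poly (Rpoly n) (tan y) * sec y ^ 2) has_real_derivative
        poly ?q (tan x) * sec x ^ 2) (at x)"
      by (rule DERIV_cong[OF DERIV_mult[OF DERIV_chain2[OF poly_DERIV tan'] sec2']])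
         (unfold q, simp add: algebra_simps)
    then have "(?D has_real_derivative poly ?q (tan x) * sec x ^ 2) (at x)"
    proof (rule has_field_derivative_transform_within_open)
      show "open {x::real. cos x \<noteq> 0}"
        by (intro open_Collect_neq continuous_intros)
    qed (use x Rpoly_spec in auto)
    then show ?thesis by (rule DERIV_imp_deriv)
  qed
  have "poly (Rpoly (Suc n)) t = poly ?q t" for t
  proof -
    have "poly (Rpoly (Suc n)) t * sec (arctan t) ^ 2 = poly ?q t * sec (arctan t) ^ 2"
      using D[of "arctan t"] Rpoly_spec[of "arctan t" "Suc n"]
      by (metis cos_arctan_not_zero funpow.simps(2) comp_apply tan_arctan)
    moreover have "sec (arctan t) \<noteq> 0" by (simp add: sec_def)
    ultimately show ?thesis by simp
  qed
  then show ?thesis by (simp add: poly_eq_poly_eq_iff[symmetric] ext)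
qed

section \<open>Descents and double descents\<close>

fun count_adj :: "('a \<Rightarrow> 'a \<Rightarrow> bool) \<Rightarrow> 'a list \<Rightarrow> nat" where
  "count_adj R (a # b # w) = of_bool (R a b) + count_adj R (b # w)"
| "count_adj R [a] = 0"
| "count_adj R [] = 0"

lemma count_adj_eq_card:
  "count_adj R w = card {i. Suc i < length w \<and> R (w ! i) (w ! Suc i)}"
proof (induction R w rule: count_adj.induct)
  case (1 R a b w)
  let ?I = "\<lambda>w. {i. Suc i < length w \<and> R (w ! i) (w ! Suc i)}"
  have split: "?I (a # b # w) = (if R a b then {0} else {}) \<union> Suc ` ?I (b # w)"
  proof (rule set_eqI)
    fix i show "i \<in> ?I (a # b # w) \<longleftrightarrow> i \<in> (if R a b then {0} else {}) \<union> Suc ` ?I (b # w)"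
      by (cases i) auto
  qed
  have fin: "finite (?I (b # w))" by (rule finite_subset[of _ "{..length w}"]) auto
  have "card (?I (a # b # w)) = of_bool (R a b) + card (?I (b # w))"
    unfolding split by (subst card_Un_disjoint) (use fin in \<open>auto simp: card_image\<close>)
  then show ?case using 1 by simp
qed auto

lemma count_adj_append:
  "count_adj R (u @ [a, b]) = count_adj R (u @ [a]) + of_bool (R a b)"
proof (induction u)
  case (Cons c u)
  then show ?case by (cases u) auto
qed simp

lemma has_double_descent_simps [simp]:
  "\<not> has_double_descent []" "\<not> has_double_descent [a]" "\<not> has_double_descent [a, b]"
  "has_double_descent (a # b # c # w) \<longleftrightarrow> a > b \<and> b > c \<or> has_double_descent (b # c # w)"
proof -
  have *: "(\<exists>i. P i) \<longleftrightarrow> P 0 \<or> (\<exists>i. P (Suc i))" for P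
    by (metis not0_implies_Suc)
  show "has_double_descent (a # b # c # w) \<longleftrightarrow> a > b \<and> b > c \<or> has_double_descent (b # c # w)"
    unfolding has_double_descent_def by (subst *) simp
qed (auto simp: has_double_descent_def)

abbreviation pos_des :: "int list \<Rightarrow> nat" where
  "pos_des \<equiv> count_adj (\<lambda>a b. a > b \<and> \<bar>a\<bar> > \<bar>b\<bar>)"

abbreviation neg_des :: "int list \<Rightarrow> nat" where
  "neg_des \<equiv> count_adj (\<lambda>a b. a > b \<and> \<bar>a\<bar> < \<bar>b\<bar>)"

text \<open>Without double descents, distinct descents occupy disjoint pairs of letters. The bound
ensures that the exponents \<open>n - 2 q\<close> are never truncated.\<close>

lemma two_des_le_length:
  "\<not> has_double_descent w \<Longrightarrow> 2 * (pos_des w + neg_des w) \<le> length w"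
proof (induction w rule: length_induct)
  case (1 w)
  consider "w = []" | a where "w = [a]" | a b where "w = [a, b]"
    | a b c v where "w = a # b # c # v" by (metis neq_Nil_conv)
  then show ?case
  proof cases
    case (4 a b c v)
    have "\<not> has_double_descent (b # c # v)" "\<not> has_double_descent (c # v)"
      using 1(2) 4 by (cases v; simp)+
    then have "2 * (pos_des (b # c # v) + neg_des (b # c # v)) \<le> length (b # c # v)"
      "2 * (pos_des (c # v) + neg_des (c # v)) \<le> length (c # v)"
      by (intro 1(1)[rule_format]; simp add: 4)+
    then show ?thesis using 1(2) 4 by auto
  qed auto
qed

section \<open>Inserting a letter of largest absolute value\<close>

definition insert_at :: "nat \<Rightarrow> 'a \<Rightarrow> 'a list \<Rightarrow> 'a list" where
  "insert_at i x w = take i w @ x # drop i w"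

lemma insert_at_simps [simp]:
  "insert_at 0 x w = x # w" "insert_at (Suc i) x (a # w) = a # insert_at i x w"
  "insert_at i x [] = [x]"
  by (simp_all add: insert_at_def)

text \<open>Sums over words are taken of an arbitrary function \<open>g\<close> of the numbers of positive and
negative descents; this replaces a bivariate generating function, with \<open>g\<close> in the role of the
monomials.\<close>

definition insertion_sum ::
    "(nat \<Rightarrow> nat \<Rightarrow> 'a::comm_ring_1) \<Rightarrow> int \<Rightarrow> int list \<Rightarrow> 'a" where
  "insertion_sum g x w = (\<Sum>i\<le>length w.
     let v = insert_at i x w in if has_double_descent v then 0 else g (pos_des v) (neg_des v))"

text \<open>The right-hand side lists the admissible places for a maximal letter \<open>m\<close>: the end of the
word and the positive descents, the negative descents, and the remaining places that do not
precede a descent top. The induction on the word reads it from the left. A new first letter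
\<open>a\<close> that ascends adds one place, in front of it. One that begins a descent \<open>a > b\<close> forbids the
place in front of it; all other places see \<open>g\<close> shifted by the new descent, except the gap
between \<open>a\<close> and \<open>b\<close>: in the shorter word it creates the descent \<open>m > b\<close>, in the longer one
that descent takes the place of \<open>a > b\<close>, so a shifted term is exchanged for an unshifted one.\<close>

lemma insertion_sum_max:
  fixes g :: "nat \<Rightarrow> nat \<Rightarrow> 'a::comm_ring_1"
  assumes "distinct (map abs w)" "\<forall>a\<in>set w. \<bar>a\<bar> < m" "\<not> has_double_descent w"
  shows "insertion_sum g m w =
    (1 + of_nat (pos_des w)) * g (pos_des w) (neg_des w)
    + of_nat (neg_des w) * g (pos_des w + 1) (neg_des w - 1)
    + (of_nat (length w) - 2 * of_nat (pos_des w + neg_des w)) * g (pos_des w + 1) (neg_des w)"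
  using assms
proof (induction w arbitrary: g)
  case Nil
  then show ?case by (simp add: insertion_sum_def)
next
  case (Cons a v)
  let ?G = "\<lambda>g w. if has_double_descent w then 0 else g (pos_des w) (neg_des w)"
  have m: "\<bar>a\<bar> < m" "a < m" using Cons.prems by auto
  show ?case
  proof (cases v)
    case Nil
    then show ?thesis using m by (simp add: insertion_sum_def)
  next
    case (Cons b u)
    have b: "\<bar>b\<bar> < m" "b < m" "\<bar>a\<bar> \<noteq> \<bar>b\<bar>" using Cons.prems Cons by auto
    have ndd: "\<not> has_double_descent v" "\<not> has_double_descent u"
      using Cons.prems(3) Cons by (cases u; cases "tl u"; auto)+
    have IH: "insertion_sum g m v =
      (1 + of_nat (pos_des v)) * g (pos_des v) (neg_des v)
      + of_nat (neg_des v) * g (pos_des v + 1) (neg_des v - 1)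
      + (of_nat (length v) - 2 * of_nat (pos_des v + neg_des v)) * g (pos_des v + 1) (neg_des v)"
      for g :: "nat \<Rightarrow> nat \<Rightarrow> 'a" by (rule Cons.IH) (use Cons.prems ndd in auto)
    have sum_v: "insertion_sum g m v = ?G g (m # b # u)
        + (\<Sum>i\<le>length u. ?G g (b # insert_at i m u))"
      for g :: "nat \<Rightarrow> nat \<Rightarrow> 'a"
      unfolding insertion_sum_def Cons Let_def
      by (simp add: sum.atMost_Suc_shift del: sum.atMost_Suc cong: if_cong)
    have sum_w: "insertion_sum g m (a # v) = ?G g (m # a # b # u) + ?G g (a # m # b # u)
        + (\<Sum>i\<le>length u. ?G g (a # b # insert_at i m u))"
      unfolding insertion_sum_def Cons Let_def
      by (simp add: sum.atMost_Suc_shift add.assoc del: sum.atMost_Suc cong: if_cong)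
    consider (asc) "a < b" | (pos) "a > b" "\<bar>a\<bar> > \<bar>b\<bar>" | (neg) "a > b" "\<bar>a\<bar> < \<bar>b\<bar>"
      using b by linarith
    then show ?thesis
    proof cases
      case asc
      have "?G g (a # b # insert_at i m u) = ?G g (b # insert_at i m u)" for i
        using asc by (cases "insert_at i m u") auto
      then have "insertion_sum g m (a # v) = g (pos_des v + 1) (neg_des v) + insertion_sum g m v"
        unfolding sum_w sum_v using asc m b Cons.prems(3) Cons
        by (cases u) (auto simp: insert_at_def)
      then show ?thesis unfolding IH using asc Cons by (simp add: algebra_simps)
    next
      case pos
      \<comment> \<open>\<open>a > b\<close> is a descent, so \<open>b\<close> cannot begin another one\<close>
      have up: "u = [] \<or> b < hd u" using Cons.prems Cons pos by (cases u) auto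
      let ?g = "\<lambda>p q. g (p + 1) q"
      have "?G g (a # b # insert_at i m u) = ?G ?g (b # insert_at i m u)" for i
        using pos up b by (cases i; cases u) auto
      then have *: "insertion_sum g m (a # v)
          = g (pos_des v + 1) (neg_des v) + insertion_sum ?g m v - ?g (pos_des v + 1) (neg_des v)"
        unfolding sum_w sum_v using pos m b Cons.prems(3) Cons up
        by (cases u) (auto simp: insert_at_def)
      have counts: "pos_des (a # v) = pos_des v + 1" "neg_des (a # v) = neg_des v"
        using pos unfolding Cons count_adj.simps by simp_all
      show ?thesis unfolding * IH counts by (simp add: algebra_simps)
    next
      case neg
      have up: "u = [] \<or> b < hd u" using Cons.prems Cons neg by (cases u) auto
      let ?g = "\<lambda>p q. g p (q + 1)"
      have "?G g (a # b # insert_at i m u) = ?G ?g (b # insert_at i m u)" for i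
        using neg up b by (cases i; cases u) auto
      then have *: "insertion_sum g m (a # v)
          = g (pos_des v + 1) (neg_des v) + insertion_sum ?g m v - ?g (pos_des v + 1) (neg_des v)"
        unfolding sum_w sum_v using neg m b Cons.prems(3) Cons up
        by (cases u) (auto simp: insert_at_def)
      \<comment> \<open>\<open>q - 1\<close> is truncated only for \<open>q = 0\<close>, where the coefficient is zero\<close>
      have "of_nat q * g (p + 1) (q - 1 + 1) = of_nat q * g (p + 1) q" for p q
        by (cases q) auto
      moreover have counts: "pos_des (a # v) = pos_des v" "neg_des (a # v) = neg_des v + 1"
        using neg unfolding Cons count_adj.simps by simp_all
      ultimately show ?thesis unfolding * IH counts by (simp add: algebra_simps)
    qed
  qed
qed

text \<open>Reversing the word and negating the letters preserves descents and exchanges their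
signs, and it carries the insertion of \<open>-m\<close> to the insertion of \<open>m\<close>.\<close>

definition mirror :: "int list \<Rightarrow> int list" where
  "mirror w = rev (map uminus w)"

lemma mirror_mirror: "mirror (mirror w) = w"
  by (simp add: mirror_def rev_map comp_def)

lemma length_mirror [simp]: "length (mirror w) = length w"
  by (simp add: mirror_def)

lemma mirror_insert_at:
  "i \<le> length w \<Longrightarrow> mirror (insert_at i x w) = insert_at (length w - i) (- x) (mirror w)"
  by (simp add: mirror_def insert_at_def rev_map take_rev drop_rev take_map drop_map)

lemma count_adj_mirror: "count_adj R (mirror w) = count_adj (\<lambda>a b. R (- b) (- a)) w"
proof (induction "\<lambda>a b. R (- b) (- a)" w rule: count_adj.induct)
  case (1 a b w)
  then show ?case by (simp add: mirror_def count_adj_append)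
qed (simp_all add: mirror_def)

lemma pos_des_mirror: "pos_des (mirror w) = neg_des w"
  and neg_des_mirror: "neg_des (mirror w) = pos_des w"
  by (simp_all add: count_adj_mirror)

lemma has_double_descent_mirror: "has_double_descent (mirror w) \<longleftrightarrow> has_double_descent w"
proof -
  have "has_double_descent (mirror w)" if dd: "has_double_descent w" for w
  proof -
    obtain i where i: "i + 2 < length w" "w ! i > w ! (i + 1)" "w ! (i + 1) > w ! (i + 2)"
      using dd by (auto simp: has_double_descent_def)
    define j where "j = length w - 3 - i"
    have "mirror w ! j = - w ! (i + 2)" "mirror w ! (j + 1) = - w ! (i + 1)"
      "mirror w ! (j + 2) = - w ! i" "j + 2 < length (mirror w)"
      using i(1) by (auto simp: mirror_def rev_nth j_def Suc_diff_Suc numeral_eq_Suc)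
    then show ?thesis using i unfolding has_double_descent_def by (intro exI[of _ j]) simp
  qed
  from this[of w] this[of "mirror w"] show ?thesis by (auto simp: mirror_mirror)
qed

lemma insertion_sum_mirror:
  "insertion_sum g (- x) w = insertion_sum (\<lambda>p q. g q p) x (mirror w)"
proof -
  have "insertion_sum g (- x) w = (\<Sum>i\<le>length w.
     let v = mirror (insert_at i (- x) w) in
       if has_double_descent v then 0 else g (neg_des v) (pos_des v))"
    by (simp only: insertion_sum_def Let_def has_double_descent_mirror
        pos_des_mirror neg_des_mirror)
  also have "\<dots> = (\<Sum>i\<le>length w. let v = insert_at (length w - i) x (mirror w) in
       if has_double_descent v then 0 else g (neg_des v) (pos_des v))"
    by (intro sum.cong refl) (simp add: mirror_insert_at)
  also have "\<dots> = insertion_sum (\<lambda>p q. g q p) x (mirror w)"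
    unfolding insertion_sum_def
    by (rule sum.reindex_bij_witness[of _ "\<lambda>i. length w - i" "\<lambda>i. length w - i"]) auto
  finally show ?thesis .
qed

lemma insertion_sum_min:
  assumes "distinct (map abs w)" "\<forall>a\<in>set w. \<bar>a\<bar> < m" "\<not> has_double_descent w"
  shows "insertion_sum g (- m) w =
    (1 + of_nat (neg_des w)) * g (pos_des w) (neg_des w)
    + of_nat (pos_des w) * g (pos_des w - 1) (neg_des w + 1)
    + (of_nat (length w) - 2 * of_nat (pos_des w + neg_des w)) * g (pos_des w) (neg_des w + 1)"
proof -
  have "distinct (map abs (mirror w))" "\<forall>a\<in>set (mirror w). \<bar>a\<bar> < m"
    using assms(1,2) by (simp_all add: mirror_def rev_map comp_def flip: rev_map)
  then show ?thesis
    unfolding insertion_sum_mirror using assms(3)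
    by (subst insertion_sum_max)
       (simp_all add: has_double_descent_mirror pos_des_mirror neg_des_mirror add.commute)
qed

section \<open>Generating signed Simsun words by insertion\<close>

definition simsun_words :: "nat \<Rightarrow> int list set" where
  "simsun_words n = {w. distinct (map abs w) \<and> abs ` set w = {1..int n} \<and>
     (\<forall>k\<in>{1..n}. \<not> has_double_descent (filter (\<lambda>a. \<bar>a\<bar> \<le> int k) w))}"

lemma length_simsun_words: "w \<in> simsun_words n \<Longrightarrow> length w = n"
  using distinct_card[of "map abs w"] by (simp add: simsun_words_def)

lemma simsun_words_abs_le: "w \<in> simsun_words n \<Longrightarrow> a \<in> set w \<Longrightarrow> \<bar>a\<bar> \<le> int n"
  by (auto simp: simsun_words_def)

lemma simsun_words_ndd: assumes "w \<in> simsun_words n" shows "\<not> has_double_descent w"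
proof (cases "n = 0")
  case True
  then show ?thesis using length_simsun_words[OF assms] by simp
next
  case False
  have "filter (\<lambda>a. \<bar>a\<bar> \<le> int n) w = w"
    using simsun_words_abs_le[OF assms] by (simp add: filter_id_conv)
  then show ?thesis using assms False by (auto simp: simsun_words_def dest: bspec[of _ _ n])
qed

lemma simsun_words_0: "simsun_words 0 = {[]}"
  by (auto simp: simsun_words_def)

lemma finite_simsun_words: "finite (simsun_words n)"
proof (rule finite_subset)
  show "simsun_words n \<subseteq> {w. set w \<subseteq> {- int n..int n} \<and> length w = n}"
    using simsun_words_abs_le length_simsun_words by fastforce
qed (rule finite_lists_length_eq; simp)

text \<open>Removing the letter \<open>x\<close> of absolute value \<open>n + 1\<close> does not change the subwords of
letters of absolute value at most \<open>k \<le> n\<close>, so the only new condition is the one on the whole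
word.\<close>

lemma in_simsun_words_Suc_iff:
  assumes "w = xs @ ys" "\<bar>x\<bar> = int (Suc n)"
  shows "xs @ x # ys \<in> simsun_words (Suc n) \<longleftrightarrow>
    w \<in> simsun_words n \<and> \<not> has_double_descent (xs @ x # ys)"
proof -
  have le: "{1..Suc n} = insert (Suc n) {1..n}" by auto
  let ?u = "xs @ x # ys"
  have filt: "filter (\<lambda>a. \<bar>a\<bar> \<le> int k) ?u = filter (\<lambda>a. \<bar>a\<bar> \<le> int k) w" if "k \<in> {1..n}" for k
    using that assms by auto
  have set: "distinct (map abs ?u) \<and> abs ` set ?u = {1..int (Suc n)} \<longleftrightarrow>
      distinct (map abs w) \<and> abs ` set w = {1..int n}"
  proof -
    have "distinct (map abs ?u) \<longleftrightarrow> distinct (map abs w) \<and> int (Suc n) \<notin> abs ` set w"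
      using assms by auto
    moreover have "abs ` set ?u = insert (int (Suc n)) (abs ` set w)"
      using assms by auto
    moreover have "{1..int (Suc n)} = insert (int (Suc n)) {1..int n}" by auto
    moreover have "int (Suc n) \<notin> {1..int n}" by simp
    ultimately show ?thesis by (metis insert_ident)
  qed
  have all: "filter (\<lambda>a. \<bar>a\<bar> \<le> int (Suc n)) ?u = ?u"
    if "abs ` set ?u = {1..int (Suc n)}"
  proof -
    have "\<bar>a\<bar> \<le> int (Suc n)" if "a \<in> set ?u" for a
      using \<open>abs ` set ?u = _\<close> that by (metis atLeastAtMost_iff imageI)
    then show ?thesis by (simp only: filter_id_conv) blast
  qed
  show ?thesis unfolding simsun_words_def mem_Collect_eq le ball_simps
    using set all filt by (metis (no_types, lifting))
qed

lemma sum_simsun_words_Suc: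
  fixes f :: "int list \<Rightarrow> 'a::comm_monoid_add" and n :: nat
  defines "m \<equiv> int (Suc n)"
  shows "(\<Sum>w\<in>simsun_words (Suc n). f w) =
    (\<Sum>w\<in>simsun_words n. \<Sum>x\<in>{m, - m}. \<Sum>i\<le>length w.
       let v = insert_at i x w in if has_double_descent v then 0 else f v)"
proof -
  let ?A = "SIGMA w:simsun_words n. {m, - m} \<times> {..length w}"
  let ?ins = "\<lambda>(w, x, i). insert_at i x w"
  let ?B = "{z \<in> ?A. \<not> has_double_descent (?ins z)}"
  have absx: "\<bar>x\<bar> = m" if "x \<in> {m, - m}" for x using that by (auto simp: m_def)
  have bij: "bij_betw ?ins ?B (simsun_words (Suc n))"
  proof (rule bij_betw_imageI)
    have "inj_on ?ins ?A"
    proof (rule inj_onI, clarify, goal_cases)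
      case (1 w x i w' x' i')
      have small: "\<bar>a\<bar> \<noteq> m" if "a \<in> set w \<union> set w'" for a
        using that simsun_words_abs_le 1 by (fastforce simp: m_def)
      have x: "\<bar>x\<bar> = m" "\<bar>x'\<bar> = m" using 1 by (auto simp: m_def)
      \<comment> \<open>the inserted letter, and with it its place, is recognised by its absolute value\<close>
      have tw: "takeWhile (\<lambda>a. \<bar>a\<bar> \<noteq> m) (insert_at i x w) = take i w"
        "takeWhile (\<lambda>a. \<bar>a\<bar> \<noteq> m) (insert_at i' x' w') = take i' w'"
        using small x unfolding insert_at_def
        by (subst takeWhile_append2; auto dest: in_set_takeD)+
      then have pre: "take i w = take i' w'" using 1 by simp
      then have "length (take i w) = length (take i' w')" by simp
      then have "i = i'" using 1 by auto
      moreover have "x # drop i w = x' # drop i' w'" using 1 pre by (simp add: insert_at_def)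
      ultimately show ?case using pre by (metis append_take_drop_id list.inject)
    qed
    then show "inj_on ?ins ?B" by (rule inj_on_subset) auto
    show "?ins ` ?B = simsun_words (Suc n)"
    proof (intro equalityI subsetI)
      fix u assume "u \<in> ?ins ` ?B"
      then obtain w x i where *: "w \<in> simsun_words n" "x \<in> {m, - m}"
        "u = insert_at i x w" "\<not> has_double_descent u" by auto
      then show "u \<in> simsun_words (Suc n)"
        using in_simsun_words_Suc_iff[of w "take i w" "drop i w" x n] absx[of x]
        by (simp add: insert_at_def m_def)
    next
      fix u assume u: "u \<in> simsun_words (Suc n)"
      then have "m \<in> abs ` set u" by (simp add: simsun_words_def m_def)
      then obtain x where x: "x \<in> set u" "\<bar>x\<bar> = m" by force
      then obtain xs ys where u_eq: "u = xs @ x # ys" by (meson split_list)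
      have "xs @ ys \<in> simsun_words n" "\<not> has_double_descent u"
        using in_simsun_words_Suc_iff[of "xs @ ys" xs ys x n] u x u_eq
        by (auto simp: m_def)
      moreover have "u = ?ins (xs @ ys, x, length xs)" by (simp add: u_eq insert_at_def)
      moreover have "x \<in> {m, - m}" using x by (auto simp: m_def)
      ultimately show "u \<in> ?ins ` ?B" by (intro image_eqI[of _ _ "(xs @ ys, x, length xs)"]) auto
    qed
  qed
  have fin: "finite ?A" by (intro finite_SigmaI) (auto simp: finite_simsun_words)
  have "(\<Sum>w\<in>simsun_words (Suc n). f w) = (\<Sum>z\<in>?B. f (?ins z))"
    by (rule sum.reindex_bij_betw[OF bij, symmetric])
  also have "\<dots> = (\<Sum>z\<in>?A. if has_double_descent (?ins z) then 0 else f (?ins z))"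
    using fin by (subst sum.inter_filter) (auto intro!: sum.cong)
  also have "\<dots> = (\<Sum>w\<in>simsun_words n. \<Sum>z\<in>{m, - m} \<times> {..length w}.
      if has_double_descent (?ins (w, z)) then 0 else f (?ins (w, z)))"
    by (subst sum.Sigma) (auto simp: finite_simsun_words intro!: sum.cong)
  also have "\<dots> = (\<Sum>w\<in>simsun_words n. \<Sum>x\<in>{m, - m}. \<Sum>i\<le>length w.
       let v = insert_at i x w in if has_double_descent v then 0 else f v)"
    unfolding Let_def by (subst sum.cartesian_product) (simp add: case_prod_unfold cong: if_cong)
  finally show ?thesis .
qed

section \<open>The symmetry between positive and negative descents\<close>

text \<open>The total effect of inserting \<open>\<plusminus>(n + 1)\<close> into a word with \<open>p\<close> positive and \<open>q\<close>
negative descents, for \<open>c = n\<close>. Its adjoint on generating functions is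
\<open>2 + E + x \<partial>/\<partial>y + y \<partial>/\<partial>x + (x + y) (c - 2 E)\<close>, where \<open>E\<close> is the Euler operator. The
parameter \<open>c\<close> is a ring element because \<open>c - 2\<close>, needed below, may be negative.\<close>

definition growth ::
    "'a::comm_ring_1 \<Rightarrow> (nat \<Rightarrow> nat \<Rightarrow> 'a) \<Rightarrow> nat \<Rightarrow> nat \<Rightarrow> 'a" where
  "growth c g p q = (2 + of_nat (p + q)) * g p q
     + of_nat q * g (p + 1) (q - 1) + of_nat p * g (p - 1) (q + 1)
     + (c - 2 * of_nat (p + q)) * (g (p + 1) q + g p (q + 1))"

lemma sum_simsun_words_growth:
  fixes g :: "nat \<Rightarrow> nat \<Rightarrow> 'a::comm_ring_1"
  shows "(\<Sum>w\<in>simsun_words (Suc n). g (pos_des w) (neg_des w)) =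
    (\<Sum>w\<in>simsun_words n. growth (of_nat n) g (pos_des w) (neg_des w))"
  unfolding sum_simsun_words_Suc
proof (rule sum.cong[OF refl])
  fix w assume w: "w \<in> simsun_words n"
  let ?m = "int (Suc n)"
  have hyps: "distinct (map abs w)" "\<forall>a\<in>set w. \<bar>a\<bar> < ?m" "\<not> has_double_descent w"
    using w simsun_words_ndd[OF w] by (auto simp: simsun_words_def dest: simsun_words_abs_le[OF w])
  have "(\<Sum>x\<in>{?m, - ?m}. \<Sum>i\<le>length w. let v = insert_at i x w in
      if has_double_descent v then 0 else g (pos_des v) (neg_des v))
    = insertion_sum g ?m w + insertion_sum g (- ?m) w"
    unfolding insertion_sum_def by (subst sum.insert) auto
  also have "\<dots> = growth (of_nat n) g (pos_des w) (neg_des w)"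
    unfolding insertion_sum_max[OF hyps] insertion_sum_min[OF hyps]
    by (simp add: growth_def length_simsun_words[OF w] algebra_simps)
  finally show "(\<Sum>x\<in>{?m, - ?m}. \<Sum>i\<le>length w. let v = insert_at i x w in
      if has_double_descent v then 0 else g (pos_des v) (neg_des v))
    = growth (of_nat n) g (pos_des w) (neg_des w)" .
qed

text \<open>The adjoint of \<open>\<partial>/\<partial>y - \<partial>/\<partial>x\<close>, acting on functions of the exponents.\<close>

definition exchange :: "(nat \<Rightarrow> nat \<Rightarrow> 'a::comm_ring_1) \<Rightarrow> nat \<Rightarrow> nat \<Rightarrow> 'a" where
  "exchange h p q = of_nat q * h p (q - 1) - of_nat p * h (p - 1) q"

text \<open>Write \<open>D = \<partial>/\<partial>y - \<partial>/\<partial>x\<close>. It satisfies \<open>[D, E] = D\<close> and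
\<open>[D, x \<partial>/\<partial>y + y \<partial>/\<partial>x] = -D\<close>, so these two contributions cancel; moreover \<open>D\<close> kills
\<open>x + y\<close> and lowers the degree by one, which replaces \<open>c - 2 E\<close> by \<open>c - 2 - 2 E\<close>.\<close>

lemma growth_exchange: "growth c (exchange h) p q = exchange (growth (c - 2) h) p q"
proof -
  have cases: "k = 0 \<or> k = 1 \<or> (\<exists>j. k = Suc (Suc j))" for k :: nat
    by (metis One_nat_def not0_implies_Suc)
  show ?thesis
    using cases[of p] cases[of q]
    by (elim disjE exE; simp add: growth_def exchange_def algebra_simps)
qed

text \<open>The identity says that the words with \<open>p\<close> positive and \<open>q + 1\<close> negative descents, each
counted \<open>q + 1\<close> times, are as many as those with \<open>p + 1\<close> positive and \<open>q\<close> negative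
descents, each counted \<open>p + 1\<close> times. The induction needs it for every \<open>h\<close>, since passing to
smaller words replaces \<open>h\<close> by its image under the insertion operator.\<close>

lemma sum_exchange_simsun_words:
  "(\<Sum>w\<in>simsun_words n. exchange h (pos_des w) (neg_des w)) = 0"
proof (induction n arbitrary: h)
  case 0
  then show ?case by (simp add: simsun_words_0 exchange_def)
next
  case (Suc n)
  then show ?case by (simp add: sum_simsun_words_growth growth_exchange)
qed

section \<open>The recurrence for the sum over words\<close>

text \<open>The first two terms on the right are \<open>2 x f + (1 + x\<^sup>2) f'\<close> for \<open>f = x ^ (n - 2 q)\<close>. With
\<open>m = n - 2 q\<close>, the difference between insertion and this recurrence is
\<open>(1 + x\<^sup>2) (q x\<^sup>2 - p) x ^ (m - 1)\<close>, which is of the form of an exchange. A truncated exponent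
occurs only with coefficient zero.\<close>

lemma growth_power:
  fixes x :: "'a::comm_ring_1"
  assumes "2 * (p + q) \<le> n"
  shows "growth (of_nat n) (\<lambda>_ q. x ^ (Suc n - 2 * q)) p q =
    2 * x * x ^ (n - 2 * q) + (1 + x ^ 2) * (of_nat (n - 2 * q) * x ^ (n - 2 * q - 1))
    + exchange (\<lambda>_ q. x ^ (n + 1 - 2 * q) + x ^ (n - 1 - 2 * q)) p q"
proof -
  obtain r where n: "n = r + 2 * p + 2 * q" using assms
    by (metis add.assoc add.commute le_Suc_ex distrib_left)
  show ?thesis
    unfolding n
    by (cases p; cases q; cases r)
      (simp_all add: growth_def exchange_def algebra_simps power_add
        power2_eq_square power3_eq_cube power4_eq_xxxx)
qed

lemma Rpoly_eq_sum_simsun_words: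
  "Rpoly n = (\<Sum>w\<in>simsun_words n. [:0, 1:] ^ (n - 2 * neg_des w))"
proof (induction n)
  case 0
  then show ?case by (simp add: Rpoly_0 simsun_words_0)
next
  case (Suc n)
  let ?x = "[:0, 1:] :: real poly"
  let ?h = "\<lambda>_ q. ?x ^ (n + 1 - 2 * q) + ?x ^ (n - 1 - 2 * q)"
  let ?t = "\<lambda>w. 2 * ?x * ?x ^ (n - 2 * neg_des w)
      + (1 + ?x ^ 2) * (of_nat (n - 2 * neg_des w) * ?x ^ (n - 2 * neg_des w - 1))"
  have "(\<Sum>w\<in>simsun_words (Suc n). ?x ^ (Suc n - 2 * neg_des w))
      = (\<Sum>w\<in>simsun_words n.
          growth (of_nat n) (\<lambda>_ q. ?x ^ (Suc n - 2 * q)) (pos_des w) (neg_des w))"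
    by (rule sum_simsun_words_growth)
  also have "\<dots> = (\<Sum>w\<in>simsun_words n. ?t w + exchange ?h (pos_des w) (neg_des w))"
  proof (rule sum.cong[OF refl], rule growth_power)
    fix w assume w: "w \<in> simsun_words n"
    show "2 * (pos_des w + neg_des w) \<le> n"
      using two_des_le_length[OF simsun_words_ndd[OF w]] length_simsun_words[OF w] by simp
  qed
  also have "\<dots> = (\<Sum>w\<in>simsun_words n. ?t w)"
    unfolding sum.distrib sum_exchange_simsun_words by simp
  also have "\<dots> = [:0, 2:] * Rpoly n + [:1, 0, 1:] * pderiv (Rpoly n)"
  proof -
    have 1: "[:0, 2:] = 2 * ?x" "[:1, 0, 1:] = 1 + ?x ^ 2"
      by (simp_all add: power2_eq_square numeral_poly one_pCons)
    have 2: "pderiv (?x ^ k) = of_nat k * ?x ^ (k - 1)" for k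
      by (simp add: pderiv_power pderiv_pCons of_nat_poly)
    show ?thesis
      unfolding Suc.IH 1
      by (simp only: higher_pderiv_sum[of 1, simplified] 2 sum.distrib sum_distrib_left)
  qed
  finally show ?case by (simp add: Rpoly_Suc)
qed

section \<open>From signed permutations to words\<close>

lemma nva_eq_neg_des: "nva n \<sigma> = neg_des (word n \<sigma>)"
proof -
  let ?I = "{i. Suc i < length (word n \<sigma>) \<and> word n \<sigma> ! i > word n \<sigma> ! Suc i
     \<and> \<bar>word n \<sigma> ! i\<bar> < \<bar>word n \<sigma> ! Suc i\<bar>}"
  have nth: "word n \<sigma> ! i = \<sigma> (int i + 1)" if "i < n" for i
    using that by (simp add: word_def add.commute del: upt_Suc)
  have len: "length (word n \<sigma>) = n" by (simp add: word_def)
  have "bij_betw (\<lambda>i. int i + 2) ?I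
     {i \<in> {2..int n}. \<sigma> i < 0 \<and> \<sigma> (i - 1) > \<sigma> i \<and> \<bar>\<sigma> (i - 1)\<bar> < \<bar>\<sigma> i\<bar>}"
    by (rule bij_betw_byWitness[where f' = "\<lambda>i. nat (i - 2)"])
       (auto simp: len nth nat_diff_distrib Suc_nat_eq_nat_zadd1 add.commute)
  then show ?thesis by (simp add: nva_def count_adj_eq_card bij_betw_same_card)
qed

text \<open>A signed permutation is determined by its values on \<open>1, ..., n\<close>, since it is odd and is
the identity elsewhere; conversely a word in which every absolute value occurs exactly once
extends to one.\<close>

lemma bij_betw_word: "bij_betw (word n) (RSII n) (simsun_words n)"
proof (rule bij_betw_imageI)
  let ?S = "{- int n..int n} - {0}"
  have nth: "word n \<sigma> ! i = \<sigma> (int i + 1)" if "i < n" for \<sigma> i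
    using that by (simp add: word_def add.commute del: upt_Suc)
  have set_word: "set (word n \<sigma>) = \<sigma> ` {1..int n}" for \<sigma>
  proof -
    have "{1..int n} = int ` {1..n}"
      using image_int_atLeastAtMost[of 1 n] by simp
    then show ?thesis
      by (simp add: word_def image_image atLeastLessThanSuc_atLeastAtMost del: upt_Suc)
  qed
  show "inj_on (word n) (RSII n)"
  proof (rule inj_onI)
    fix \<sigma> \<tau> assume "\<sigma> \<in> RSII n" "\<tau> \<in> RSII n" and eq: "word n \<sigma> = word n \<tau>"
    then have perm: "\<sigma> permutes ?S" "\<tau> permutes ?S"
      and odd: "\<And>i. \<sigma> (- i) = - \<sigma> i" "\<And>i. \<tau> (- i) = - \<tau> i"
      by (auto simp: RSII_def signed_perms_def)
    have pos: "\<sigma> i = \<tau> i" if "i \<in> {1..int n}" for i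
      using that nth[of "nat (i - 1)" \<sigma>] nth[of "nat (i - 1)" \<tau>] eq by auto
    show "\<sigma> = \<tau>"
    proof
      fix i
      consider "i \<in> {1..int n}" | "- i \<in> {1..int n}" | "i \<notin> ?S" by force
      then show "\<sigma> i = \<tau> i"
      proof cases
        case 2
        then show ?thesis using pos[of "- i"] odd by simp
      next
        case 3
        then show ?thesis using permutes_not_in[OF perm(1)] permutes_not_in[OF perm(2)] by metis
      qed (use pos in blast)
    qed
  qed
  show "word n ` RSII n = simsun_words n"
  proof (intro equalityI subsetI)
    fix w assume "w \<in> word n ` RSII n"
    then obtain \<sigma> where w: "w = word n \<sigma>" and \<sigma>: "\<sigma> \<in> RSII n" by blast
    then have perm: "\<sigma> permutes ?S" and odd: "\<And>i. \<sigma> (- i) = - \<sigma> i"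
      by (auto simp: RSII_def signed_perms_def)
    have inj: "inj \<sigma>" by (rule permutes_inj[OF perm])
    have "inj_on (\<lambda>i. \<bar>\<sigma> (int i)\<bar>) (set [1..<Suc n])"
    proof (rule inj_onI)
      fix i j :: nat assume ij: "i \<in> set [1..<Suc n]" "j \<in> set [1..<Suc n]"
        and "\<bar>\<sigma> (int i)\<bar> = \<bar>\<sigma> (int j)\<bar>"
      then have "\<sigma> (int i) = \<sigma> (int j) \<or> \<sigma> (int i) = \<sigma> (- int j)"
        by (simp add: odd abs_eq_iff)
      then have "int i = int j \<or> int i = - int j" using injD[OF inj] by blast
      then show "i = j" using ij by auto
    qed
    then have dist: "distinct (map abs w)"
      unfolding w word_def by (simp add: distinct_map comp_def del: upt_Suc)
    have abs_set: "abs ` set w = {1..int n}"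
    proof (intro equalityI subsetI)
      fix k assume "k \<in> abs ` set w"
      then obtain i where i: "i \<in> {1..int n}" "k = \<bar>\<sigma> i\<bar>" by (auto simp: w set_word)
      then have "\<sigma> i \<in> ?S" using permutes_in_image[OF perm, of i] by auto
      then show "k \<in> {1..int n}" using i by auto
    next
      fix k assume k: "k \<in> {1..int n}"
      then have "k \<in> \<sigma> ` ?S" unfolding permutes_image[OF perm] by auto
      then obtain j where j: "j \<in> ?S" "\<sigma> j = k" by blast
      have "\<bar>j\<bar> \<in> {1..int n}" using j by auto
      moreover have "\<bar>\<sigma> \<bar>j\<bar>\<bar> = k" using j k odd[of j] by (cases "j \<ge> 0") auto
      ultimately show "k \<in> abs ` set w" unfolding w set_word by (metis imageI)
    qed
    show "w \<in> simsun_words n"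
      using \<sigma> dist abs_set by (simp add: simsun_words_def RSII_def subword_def w)
  next
    fix w assume w: "w \<in> simsun_words n"
    then have dist: "distinct (map abs w)" and abs_set: "abs ` set w = {1..int n}"
      by (auto simp: simsun_words_def)
    have len: "length w = n" by (rule length_simsun_words[OF w])
    \<comment> \<open>the odd extension of \<open>w\<close>, and the identity outside \<open>\<plusminus>1, ..., \<plusminus>n\<close>\<close>
    define \<sigma> where "\<sigma> i = (if i \<in> {1..int n} then w ! nat (i - 1)
      else if - i \<in> {1..int n} then - w ! nat (- i - 1) else i)" for i
    have odd: "\<sigma> (- i) = - \<sigma> i" for i by (auto simp: \<sigma>_def)
    have abs_\<sigma>: "\<bar>\<sigma> i\<bar> = \<bar>w ! nat (\<bar>i\<bar> - 1)\<bar>" if "i \<in> ?S" for i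
      using that by (auto simp: \<sigma>_def)
    have idx: "nat (\<bar>i\<bar> - 1) < n" if "i \<in> ?S" for i using that by auto
    have range: "\<bar>\<sigma> i\<bar> \<in> {1..int n}" if "i \<in> ?S" for i
    proof -
      have "w ! nat (\<bar>i\<bar> - 1) \<in> set w" using idx[OF that] len by simp
      then show ?thesis unfolding abs_\<sigma>[OF that] using abs_set by blast
    qed
    have inj: "inj_on \<sigma> ?S"
    proof (rule inj_onI)
      fix i j assume ij: "i \<in> ?S" "j \<in> ?S" "\<sigma> i = \<sigma> j"
      then have "map abs w ! nat (\<bar>i\<bar> - 1) = map abs w ! nat (\<bar>j\<bar> - 1)"
        using abs_\<sigma> idx len by (metis nth_map)
      then have "nat (\<bar>i\<bar> - 1) = nat (\<bar>j\<bar> - 1)"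
        using dist idx ij(1,2) len by (simp only: nth_eq_iff_index_eq length_map)
      then have "i = j \<or> i = - j" using ij by auto
      moreover have "\<sigma> i \<noteq> 0" using range[OF ij(1)] by auto
      ultimately show "i = j" using odd[of j] ij(3) by auto
    qed
    have "\<sigma> ` ?S \<subseteq> ?S" using range by (fastforce simp: abs_le_iff)
    then have "\<sigma> ` ?S = ?S" by (intro endo_inj_surj inj) simp
    with inj have "bij_betw \<sigma> ?S ?S" by (rule bij_betw_imageI)
    then have "\<sigma> permutes ?S" by (rule bij_imp_permutes) (auto simp: \<sigma>_def)
    then have signed: "\<sigma> \<in> signed_perms n" using odd by (simp add: signed_perms_def)
    have word: "word n \<sigma> = w"
      by (rule nth_equalityI) (auto simp: nth len \<sigma>_def word_def simp del: upt_Suc)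
    have "\<sigma> \<in> RSII n"
      using w signed by (simp add: RSII_def subword_def word simsun_words_def)
    then show "w \<in> word n ` RSII n" using word by force
  qed
qed

theorem theorem2p12:
  fixes n :: nat
  assumes "n \<ge> 1"
  shows "Rpoly n = (\<Sum>\<sigma>\<in>RSII n. monom 1 (n - 2 * nva n \<sigma>))"
proof -
  have "Rpoly n = (\<Sum>w\<in>simsun_words n. [:0, 1:] ^ (n - 2 * neg_des w))"
    by (rule Rpoly_eq_sum_simsun_words)
  also have "\<dots> = (\<Sum>\<sigma>\<in>RSII n. [:0, 1:] ^ (n - 2 * neg_des (word n \<sigma>)))"
    by (rule sum.reindex_bij_betw[OF bij_betw_word, symmetric])
  also have "\<dots> = (\<Sum>\<sigma>\<in>RSII n. monom 1 (n - 2 * nva n \<sigma>))"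
    by (simp add: nva_eq_neg_des monom_altdef)
  finally show ?thesis .
qed

end
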